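(* Let $\mathcal{G} = (\mathcal{V}_{\mathsf{x}}, \mathcal{E}_{\mathsf{x}})$ be an exchange graph with unit vertex weights, $w(v) = 1$ for all $v \in \mathcal{V}_{\mathsf{x}}$, let $b$ be an integer with $1 \leq b \leq |\mathcal{V}_{\mathsf{x}}|$, let $f_{\mathrm{e}} : 2^{\mathcal{E}_{\mathsf{x}}} \to \mathbb{R}_{\geq 0}$ be NMS, and let $f_{\mathrm{v}}(\mathcal{V}) = f_{\mathrm{e}}(\mathrm{edges}(\mathcal{V}))$ for $\mathcal{V} \subseteq \mathcal{V}_{\mathsf{x}}$. Let $\mathcal{V}_{\mathrm{grd}}$ be any set produced by the standard greedy algorithm run for $b$ rounds on $f_{\mathrm{v}}$, and let $\mathcal{E}_{\mathrm{grd}} = \mathrm{edges}(\mathcal{V}_{\mathrm{grd}})$. Then $f_{\mathrm{v}}(\mathcal{V}_{\mathrm{grd}}) \geq (1 - 1/e) \cdot \mathrm{OPT}_{\mathrm{v}}$; moreover $\mathcal{E}_{\mathrm{grd}}$ is feasible for the edge selection problem $(\mathtt{P}_{\mathrm{e}})$ and $f_{\mathrm{e}}(\mathcal{E}_{\mathrm{grd}}) \geq (1 - 1/e) \cdot \mathrm{OPT}_{\mathrm{e}}$.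
   Context: An exchange graph is a finite simple undirected graph $\mathcal{G} = (\mathcal{V}_{\mathsf{x}}, \mathcal{E}_{\mathsf{x}})$ with vertex weights $w : \mathcal{V}_{\mathsf{x}} \to \mathbb{R}_{>0}$ (it also carries edge probabilities $p : \mathcal{E}_{\mathsf{x}} \to (0,1]$, not used here). For $\mathcal{V} \subseteq \mathcal{V}_{\mathsf{x}}$, $\mathrm{edges}(\mathcal{V})$ is the set of all edges in $\mathcal{E}_{\mathsf{x}}$ having at least one endpoint in $\mathcal{V}$. A set function $f : 2^{\mathcal{W}} \to \mathbb{R}_{\geq 0}$ on a finite set $\mathcal{W}$ is NMS if $f(\varnothing) = 0$ (normalized), $f(\mathcal{A}) \leq f(\mathcal{B})$ whenever $\mathcal{A} \subseteq \mathcal{B}$ (monotone), and $f(\mathcal{A}) + f(\mathcal{B}) \geq f(\mathcal{A} \cup \mathcal{B}) + f(\mathcal{A} \cap \mathcal{B})$ for all $\mathcal{A}, \mathcal{B} \subseteq \mathcal{W}$ (submodular). With unit weights, the two problems are as follows. Edge selection problem $(\mathtt{P}_{\mathrm{e}})$: maximize $f_{\mathrm{e}}(\mathcal{E})$ over those $\mathcal{E} \subseteq \mathcal{E}_{\mathsf{x}}$ such that the minimum cardinality of a vertex cover of $\mathcal{E}$ (a set of vertices meeting every edge of $\mathcal{E}$) is at most $b$; its optimal value is $\mathrm{OPT}_{\mathrm{e}}$. Vertex selection problem $(\mathtt{P}_{\mathrm{v}})$: maximize $f_{\mathrm{v}}(\mathcal{V})$ over $\mathcal{V} \subseteq \mathcal{V}_{\mathsf{x}}$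 with $|\mathcal{V}| \leq b$; its optimal value is $\mathrm{OPT}_{\mathrm{v}}$. Standard greedy algorithm: start with $\mathcal{V} = \varnothing$; in each of $b$ rounds, choose a vertex $v \in \mathcal{V}_{\mathsf{x}} \setminus \mathcal{V}$ with the highest marginal gain $f_{\mathrm{v}}(\mathcal{V} \cup \{v\}) - f_{\mathrm{v}}(\mathcal{V})$ (ties broken arbitrarily), and replace $\mathcal{V}$ by $\mathcal{V} \cup \{v\}$. The output $\mathcal{V}_{\mathrm{grd}}$ is the set obtained after $b$ rounds. Here $e$ in $1 - 1/e$ is Euler's number. *)

theory Defs
  imports Complex_Main
begin

text \<open>Edges are two-element sets of vertices, so the graph is undirected, loopless and has no
  multiple edges.  Weights and probabilities are total functions, constrained on
  \<open>V\<close> and \<open>E\<close> only.\<close>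

locale exchange_graph =
  fixes V :: "'a set" and E :: "'a set set" and w :: "'a \<Rightarrow> real" and p :: "'a set \<Rightarrow> real"
  assumes finite_vertices: "finite V"
    and edge_doubleton: "e \<in> E \<Longrightarrow> e \<subseteq> V \<and> card e = 2"
    and weight_pos: "v \<in> V \<Longrightarrow> 0 < w v"
    and prob_range: "e \<in> E \<Longrightarrow> 0 < p e \<and> p e \<le> 1"

definition edges :: "'a set set \<Rightarrow> 'a set \<Rightarrow> 'a set set" where
  "edges E S = {e \<in> E. e \<inter> S \<noteq> {}}"

text \<open>A set function on \<open>W\<close> is a function on all sets of which only the values on
  subsets of \<open>W\<close> matter; its codomain, the nonnegative reals, is part of the predicate.\<close>

definition NMS :: "'b set \<Rightarrow> ('b set \<Rightarrow> real) \<Rightarrow> bool" where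
  "NMS W f \<longleftrightarrow>
     (\<forall>A. A \<subseteq> W \<longrightarrow> 0 \<le> f A) \<and>
     f {} = 0 \<and>
     (\<forall>A B. A \<subseteq> B \<and> B \<subseteq> W \<longrightarrow> f A \<le> f B) \<and>
     (\<forall>A B. A \<subseteq> W \<and> B \<subseteq> W \<longrightarrow> f A + f B \<ge> f (A \<union> B) + f (A \<inter> B))"

definition vertex_cover :: "'a set \<Rightarrow> 'a set set \<Rightarrow> 'a set \<Rightarrow> bool" where
  "vertex_cover V F C \<longleftrightarrow> C \<subseteq> V \<and> (\<forall>e\<in>F. e \<inter> C \<noteq> {})"

text \<open>In an exchange graph the sets under \<open>Min\<close> and \<open>Max\<close> below are finite and
  nonempty for \<open>F \<subseteq> E\<close>: \<open>V\<close> covers \<open>F\<close>, and the empty set is feasible for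
  both problems.\<close>

definition vertex_cover_number :: "'a set \<Rightarrow> 'a set set \<Rightarrow> nat" where
  "vertex_cover_number V F = Min (card ` {C. vertex_cover V F C})"

definition edge_feasible :: "'a set \<Rightarrow> 'a set set \<Rightarrow> nat \<Rightarrow> 'a set set \<Rightarrow> bool" where
  "edge_feasible V E b F \<longleftrightarrow> F \<subseteq> E \<and> vertex_cover_number V F \<le> b"

definition OPT_e :: "'a set \<Rightarrow> 'a set set \<Rightarrow> nat \<Rightarrow> ('a set set \<Rightarrow> real) \<Rightarrow> real" where
  "OPT_e V E b fe = Max (fe ` {F. edge_feasible V E b F})"

definition vertex_feasible :: "'a set \<Rightarrow> nat \<Rightarrow> 'a set \<Rightarrow> bool" where
  "vertex_feasible V b S \<longleftrightarrow> S \<subseteq> V \<and> card S \<le> b"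

definition OPT_v :: "'a set \<Rightarrow> nat \<Rightarrow> ('a set \<Rightarrow> real) \<Rightarrow> real" where
  "OPT_v V b fv = Max (fv ` {S. vertex_feasible V b S})"

text \<open>\<open>greedy V f k S\<close>: some run of the greedy algorithm, under some tie-breaking,
  holds the set \<open>S\<close> after \<open>k\<close> rounds.\<close>

inductive greedy :: "'a set \<Rightarrow> ('a set \<Rightarrow> real) \<Rightarrow> nat \<Rightarrow> 'a set \<Rightarrow> bool"
  for V :: "'a set" and f :: "'a set \<Rightarrow> real" where
  start: "greedy V f 0 {}"
| round: "greedy V f k S \<Longrightarrow>
          is_arg_max (\<lambda>v. f (S \<union> {v}) - f S) (\<lambda>v. v \<in> V - S) v \<Longrightarrow>
          greedy V f (Suc k) (S \<union> {v})"

end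

theory Submission
  imports Defs
begin

text \<open>Edge sets depend on vertex sets through unions, so the vertex objective inherits
  normalization, monotonicity and submodularity, and the classical greedy analysis applies: each
  round closes at least a fraction 1/b of the gap to the value of any competitor of size at most b.
  The edge problem reduces to the vertex problem, since a set of edges with a cover C is
  contained in the set of all edges meeting C.\<close>

lemma edges_subset: "edges E S \<subseteq> E"
  by (auto simp: edges_def)

lemma edges_mono: "A \<subseteq> B \<Longrightarrow> edges E A \<subseteq> edges E B"
  by (auto simp: edges_def)

lemma edges_Un: "edges E (A \<union> B) = edges E A \<union> edges E B"
  by (auto simp: edges_def)

text \<open>\<open>edges E\<close> turns unions into unions, but intersections only into subsets: an
  edge joining \<open>A - B\<close> to \<open>B - A\<close> meets both sets and may miss
  \<open>A \<inter> B\<close>. Submodularity of \<open>fv\<close> therefore draws on monotonicity of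
  \<open>fe\<close> as well as its submodularity.\<close>

lemma NMS_edges:
  assumes fe: "NMS E fe" and fv: "\<And>S. S \<subseteq> V \<Longrightarrow> fv S = fe (edges E S)"
  shows "NMS V fv"
proof -
  have nonneg: "0 \<le> fe A" if "A \<subseteq> E" for A
    using fe that by (simp add: NMS_def)
  have empty: "fe {} = 0"
    using fe by (simp add: NMS_def)
  have mono: "fe A \<le> fe B" if "A \<subseteq> B" "B \<subseteq> E" for A B
    using fe that by (simp add: NMS_def)
  have submod: "fe (A \<union> B) + fe (A \<inter> B) \<le> fe A + fe B" if "A \<subseteq> E" "B \<subseteq> E" for A B
    using fe that by (simp add: NMS_def)
  have fv_mono: "fv A \<le> fv B" if "A \<subseteq> B" "B \<subseteq> V" for A B
  proof -
    have "A \<subseteq> V" using that by blast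
    then show ?thesis
      using mono[OF edges_mono[OF that(1)] edges_subset] that fv by simp
  qed
  have fv_submod: "fv (A \<union> B) + fv (A \<inter> B) \<le> fv A + fv B" if "A \<subseteq> V" "B \<subseteq> V" for A B
  proof -
    have "fe (edges E (A \<inter> B)) \<le> fe (edges E A \<inter> edges E B)"
      by (rule mono) (auto simp: edges_def)
    moreover have "fe (edges E (A \<union> B)) + fe (edges E A \<inter> edges E B)
        \<le> fe (edges E A) + fe (edges E B)"
      unfolding edges_Un by (intro submod edges_subset)
    moreover have "A \<union> B \<subseteq> V" "A \<inter> B \<subseteq> V" using that by auto
    ultimately show ?thesis using that by (simp add: fv)
  qed
  have "edges E {} = {}" by (simp add: edges_def)
  then have "fv {} = 0" using empty fv by simp
  moreover have "0 \<le> fv A" if "A \<subseteq> V" for A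
    using that fv nonneg[OF edges_subset] by simp
  ultimately show ?thesis
    using fv_mono fv_submod unfolding NMS_def by blast
qed

text \<open>Diminishing returns: adding \<open>x\<close> to \<open>S \<union> T\<close> gains at
  most what adding it to \<open>S\<close> gains, because \<open>S \<union> T\<close> and
  \<open>S \<union> {x}\<close> meet exactly in \<open>S\<close> when \<open>x\<close> is not in
  \<open>T\<close>. Where \<open>T\<close> overlaps \<open>S\<close> the summands vanish.\<close>

lemma NMS_union_le_sum_gains:
  assumes f: "NMS W f" and "finite T" "S \<subseteq> W" "T \<subseteq> W"
  shows "f (S \<union> T) \<le> f S + (\<Sum>v\<in>T. f (S \<union> {v}) - f S)"
  using \<open>finite T\<close> \<open>T \<subseteq> W\<close>
proof (induction T rule: finite_induct)
  case empty
  then show ?case by simp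
next
  case (insert x T)
  have "(S \<union> T) \<union> (S \<union> {x}) = S \<union> insert x T" "(S \<union> T) \<inter> (S \<union> {x}) = S \<union> (T \<inter> {x})"
    by auto
  moreover have "T \<inter> {x} = {}" using insert.hyps by simp
  moreover have "f ((S \<union> T) \<union> (S \<union> {x})) + f ((S \<union> T) \<inter> (S \<union> {x})) \<le> f (S \<union> T) + f (S \<union> {x})"
  proof -
    have "S \<union> T \<subseteq> W" "S \<union> {x} \<subseteq> W" using insert.prems \<open>S \<subseteq> W\<close> by auto
    then show ?thesis using f unfolding NMS_def by blast
  qed
  ultimately have "f (S \<union> insert x T) + f S \<le> f (S \<union> T) + f (S \<union> {x})"
    by simp
  then show ?case using insert by simp
qed

lemma greedy_subset_card:
  assumes "greedy V f k S"
  shows "S \<subseteq> V \<and> finite S \<and> card S = k"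
  using assms by (induction rule: greedy.induct) (auto simp: is_arg_max_def)

text \<open>The competitor \<open>T\<close> is arbitrary rather than optimal, so that the bound can
  later be applied also to a vertex cover coming from the edge problem.\<close>

lemma greedy_gap:
  assumes "greedy V f k S" and f: "NMS V f" and "finite V"
    and T: "T \<subseteq> V" "card T \<le> b" and "1 \<le> b"
  shows "f T - f S \<le> (1 - 1 / real b) ^ k * f T"
  using assms(1)
proof (induction rule: greedy.induct)
  case start
  then show ?case using f by (simp add: NMS_def)
next
  case (round k S v)
  have S: "S \<subseteq> V" using greedy_subset_card[OF round.hyps(1)] by simp
  have mono: "f A \<le> f B" if "A \<subseteq> B" "B \<subseteq> V" for A B
    using f that by (simp add: NMS_def)
  define g where "g = f (S \<union> {v}) - f S"
  have v: "v \<in> V" using round.hyps(2) by (simp add: is_arg_max_def)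
  have "0 \<le> g"
    using mono[of S "S \<union> {v}"] S v by (auto simp: g_def)
  \<comment> \<open>The greedy choice compares \<open>v\<close> only with vertices outside
    \<open>S\<close>; a vertex already in \<open>S\<close> has gain 0, which is at most
    \<open>g\<close> by monotonicity.\<close>
  have gain_le: "f (S \<union> {u}) - f S \<le> g" if "u \<in> T" for u
  proof (cases "u \<in> S")
    case True
    then show ?thesis using \<open>0 \<le> g\<close> by (simp add: insert_absorb)
  next
    case False
    then show ?thesis
      using round.hyps(2) T(1) that unfolding is_arg_max_linorder g_def by blast
  qed
  have "f T \<le> f (S \<union> T)" using mono S T(1) by simp
  also have "\<dots> \<le> f S + (\<Sum>u\<in>T. f (S \<union> {u}) - f S)"
    using NMS_union_le_sum_gains[OF f finite_subset[OF T(1) \<open>finite V\<close>] S T(1)] .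
  also have "\<dots> \<le> f S + real (card T) * g"
    using sum_bounded_above[of T "\<lambda>u. f (S \<union> {u}) - f S" g] gain_le by simp
  also have "\<dots> \<le> f S + real b * g"
    using T(2) \<open>0 \<le> g\<close> by (simp add: mult_right_mono)
  finally have "(f T - f S) / real b \<le> g"
    using \<open>1 \<le> b\<close> by (simp add: field_simps)
  \<comment> \<open>The new gap is the old gap minus \<open>g\<close>, and \<open>g\<close> is at
    least a \<open>1 / b\<close> share of the old gap.\<close>
  then have "f T - f (S \<union> {v}) \<le> (1 - 1 / real b) * (f T - f S)"
    by (simp add: g_def algebra_simps diff_divide_distrib)
  also have "\<dots> \<le> (1 - 1 / real b) * ((1 - 1 / real b) ^ k * f T)"
    using round.IH \<open>1 \<le> b\<close> by (intro mult_left_mono) auto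
  finally show ?case by simp
qed

text \<open>This is \<open>1 + x \<le> exp x\<close> at \<open>x = - 1 / b\<close>, raised to the
  power \<open>b\<close>; the base is nonnegative because \<open>b\<close> is at least 1.\<close>

lemma one_minus_inverse_power_le:
  assumes "1 \<le> b"
  shows "(1 - 1 / real b) ^ b \<le> 1 / exp 1"
proof -
  have "(1 - 1 / real b) ^ b \<le> exp (- 1 / real b) ^ b"
    using assms exp_ge_add_one_self[of "- 1 / real b"] by (intro power_mono) auto
  also have "\<dots> = exp (- 1)"
    using assms by (simp flip: exp_of_nat_mult)
  finally show ?thesis by (simp add: exp_minus inverse_eq_divide)
qed

lemma greedy_approx:
  assumes "greedy V f b S" and f: "NMS V f" and "finite V"
    and T: "T \<subseteq> V" "card T \<le> b" and "1 \<le> b"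
  shows "(1 - 1 / exp 1) * f T \<le> f S"
proof -
  have "0 \<le> f T" using f T(1) by (simp add: NMS_def)
  have "f T - f S \<le> (1 - 1 / real b) ^ b * f T"
    by (rule greedy_gap) (use assms in auto)
  also have "\<dots> \<le> (1 / exp 1) * f T"
    using one_minus_inverse_power_le[OF \<open>1 \<le> b\<close>] \<open>0 \<le> f T\<close> by (rule mult_right_mono)
  finally show ?thesis by (simp add: algebra_simps)
qed

lemma (in exchange_graph) vertex_cover_number_le_iff:
  assumes "F \<subseteq> E"
  shows "vertex_cover_number V F \<le> b \<longleftrightarrow> (\<exists>C. vertex_cover V F C \<and> card C \<le> b)"
proof -
  have "finite {C. vertex_cover V F C}"
    by (rule finite_subset[of _ "Pow V"]) (auto simp: vertex_cover_def finite_vertices)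
  \<comment> \<open>\<open>Min\<close> is only meaningful on a nonempty set, so some cover must be
    exhibited: \<open>V\<close> itself works, since every edge is a nonempty subset of
    \<open>V\<close>.\<close>
  moreover have "e \<inter> V \<noteq> {}" if "e \<in> F" for e
  proof -
    have "e \<subseteq> V" "card e = 2" using edge_doubleton that assms by auto
    then show ?thesis by (auto simp: Int_absorb2)
  qed
  then have "vertex_cover V F V" by (simp add: vertex_cover_def)
  ultimately show ?thesis
    unfolding vertex_cover_number_def by (subst Min_le_iff) auto
qed

lemma (in exchange_graph) finite_edge_set: "finite E"
  by (rule finite_subset[of _ "Pow V"]) (use edge_doubleton finite_vertices in auto)

theorem mainTheorem3:
  fixes V :: "'a set" and E :: "'a set set" and w :: "'a \<Rightarrow> real" and p :: "'a set \<Rightarrow> real"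
    and b :: nat and fe :: "'a set set \<Rightarrow> real" and fv :: "'a set \<Rightarrow> real"
    and Vgrd :: "'a set" and Egrd :: "'a set set"
  assumes "exchange_graph V E w p"
    and "\<And>v. v \<in> V \<Longrightarrow> w v = 1"
    and "1 \<le> b" and "b \<le> card V"
    and "NMS E fe"
    and "\<And>S. S \<subseteq> V \<Longrightarrow> fv S = fe (edges E S)"
    and "greedy V fv b Vgrd"
    and "Egrd = edges E Vgrd"
  shows "fv Vgrd \<ge> (1 - 1 / exp 1) * OPT_v V b fv \<and>
         edge_feasible V E b Egrd \<and>
         fe Egrd \<ge> (1 - 1 / exp 1) * OPT_e V E b fe"
proof -
  interpret exchange_graph V E w p by fact
  have fv: "NMS V fv" using NMS_edges assms(5,6) by blast
  have V: "Vgrd \<subseteq> V" "card Vgrd = b" using greedy_subset_card[OF assms(7)] by auto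
  have fe_grd: "fe Egrd = fv Vgrd" using assms(6,8) V by simp
  have approx: "(1 - 1 / exp 1) * fv T \<le> fv Vgrd" if "T \<subseteq> V" "card T \<le> b" for T
    using greedy_approx[OF assms(7) fv finite_vertices that assms(3)] .

  let ?Sv = "{S. vertex_feasible V b S}" and ?Se = "{F. edge_feasible V E b F}"
  have "finite ?Sv"
    by (rule finite_subset[of _ "Pow V"]) (auto simp: vertex_feasible_def finite_vertices)
  moreover have "{} \<in> ?Sv" by (simp add: vertex_feasible_def)
  \<comment> \<open>The maximum is attained, so the bound against a single feasible competitor
    suffices.\<close>
  ultimately have "OPT_v V b fv \<in> fv ` ?Sv"
    unfolding OPT_v_def by (intro Max_in) auto
  then have vertex: "(1 - 1 / exp 1) * OPT_v V b fv \<le> fv Vgrd"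
    using approx by (auto simp: vertex_feasible_def)

  have "vertex_cover V Egrd Vgrd"
    using V assms(8) by (auto simp: vertex_cover_def edges_def)
  then have feasible: "edge_feasible V E b Egrd"
    using V assms(8) vertex_cover_number_le_iff[of Egrd b] edges_subset[of E Vgrd]
    by (auto simp: edge_feasible_def)
  have "finite ?Se"
    by (rule finite_subset[of _ "Pow E"]) (auto simp: edge_feasible_def finite_edge_set)
  \<comment> \<open>\<open>Egrd\<close> witnesses that the feasible set is nonempty.\<close>
  then have "OPT_e V E b fe \<in> fe ` ?Se"
    unfolding OPT_e_def using feasible by (intro Max_in) auto
  then obtain F where F: "OPT_e V E b fe = fe F" "F \<subseteq> E" "vertex_cover_number V F \<le> b"
    by (auto simp: edge_feasible_def)
  then obtain C where C: "vertex_cover V F C" "card C \<le> b"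
    using vertex_cover_number_le_iff by blast
  then have "C \<subseteq> V" by (simp add: vertex_cover_def)
  \<comment> \<open>An optimal \<open>F\<close> need not have the form \<open>edges E C\<close>, but
    enlarging it to that form does not lower \<open>fe\<close>, and \<open>C\<close> is then a
    competitor in the vertex problem.\<close>
  have "F \<subseteq> edges E C"
    using C(1) F(2) by (auto simp: vertex_cover_def edges_def)
  then have "fe F \<le> fv C"
    using assms(5) edges_subset[of E C] assms(6)[OF \<open>C \<subseteq> V\<close>] by (simp add: NMS_def)
  then have "(1 - 1 / exp 1) * fe F \<le> (1 - 1 / exp 1) * fv C"
    by (intro mult_left_mono) auto
  also have "\<dots> \<le> fe Egrd"
    using approx[OF \<open>C \<subseteq> V\<close> C(2)] fe_grd by simp
  finally show ?thesis using vertex feasible F(1) by simp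
qed

end
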